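(* Let $(A,\dashv_A,\perp_A,\vdash_A)$ and $(B,\dashv_B,\perp_B,\vdash_B)$ be triassociative algebras over a field $\mathbb{K}$. Then the multiplications, for $a_1,a_2\in A$ and $b_1,b_2\in B$, $$(a_1+b_1)\dashv(a_2+b_2):=a_1\dashv_A a_2+b_1\dashv_B b_2,$$ $$(a_1+b_1)\perp(a_2+b_2):=a_1\perp_A a_2+b_1\perp_B b_2,$$ $$(a_1+b_1)\vdash(a_2+b_2):=a_1\vdash_A a_2+b_1\vdash_B b_2,$$ give a triassociative algebra structure on $A\oplus B$. Moreover, if $\xi:A\to B$ is a linear map, then $\xi$ is a morphism of triassociative algebras if and only if its graph $\Gamma_\xi=\{(x,\xi(x)):x\in A\}$ is a triassociative subalgebra of $(A\oplus B,\dashv,\perp,\vdash)$.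
   Context: A triassociative algebra over $\mathbb{K}$ is a $\mathbb{K}$-vector space $A$ with three bilinear maps $\dashv,\perp,\vdash:A\times A\to A$ such that for all $x,y,z\in A$: (1) $(x\dashv y)\dashv z=x\dashv(y\dashv z)$; (2) $(x\vdash y)\vdash z=x\vdash(y\vdash z)$; (3) $(x\perp y)\perp z=x\perp(y\perp z)$; (4) $(x\dashv y)\dashv z=x\dashv(y\vdash z)$; (5) $(x\dashv y)\dashv z=x\dashv(y\perp z)$; (6) $(x\vdash y)\dashv z=x\vdash(y\dashv z)$; (7) $(x\dashv y)\vdash z=x\vdash(y\vdash z)$; (8) $(x\perp y)\vdash z=x\vdash(y\vdash z)$; (9) $(x\perp y)\dashv z=x\perp(y\dashv z)$; (10) $(x\dashv y)\perp z=x\perp(y\vdash z)$; (11) $(x\vdash y)\perp z=x\vdash(y\perp z)$. A morphism of triassociative algebras is a linear map preserving each of the three products. A subalgebra is a linear subspace stable under the three products. An element $a+b$ of $A\oplus B$ ($a\in A$, $b\in B$) is identified with the pair $(a,b)$. *)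

theory Defs
  imports "HOL-Analysis.Product_Vector"
begin

text \<open>
  The predicate \<open>bilinear\<close> of \<open>HOL-Analysis.Linear_Algebra\<close> is restricted to real vector spaces;
  this is the same definition over an arbitrary field, for a product on one space.
\<close>

definition bilinear_product :: "('k::field \<Rightarrow> 'a::ab_group_add \<Rightarrow> 'a) \<Rightarrow> ('a \<Rightarrow> 'a \<Rightarrow> 'a) \<Rightarrow> bool"
  where "bilinear_product smult f \<longleftrightarrow>
    (\<forall>x. Vector_Spaces.linear smult smult (\<lambda>y. f x y)) \<and>
    (\<forall>y. Vector_Spaces.linear smult smult (\<lambda>x. f x y))"

locale triassociative_algebra = vector_space smult
  for smult :: "'k::field \<Rightarrow> 'a::ab_group_add \<Rightarrow> 'a" +
  fixes left :: "'a \<Rightarrow> 'a \<Rightarrow> 'a"  (infixl \<open>\<stileturn>\<close> 70)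
    and mid :: "'a \<Rightarrow> 'a \<Rightarrow> 'a"  (infixl \<open>\<bottom>\<close> 70)
    and right :: "'a \<Rightarrow> 'a \<Rightarrow> 'a"  (infixl \<open>\<turnstile>\<close> 70)
  assumes bilinear_left: "bilinear_product smult (\<stileturn>)"
    and bilinear_mid: "bilinear_product smult (\<bottom>)"
    and bilinear_right: "bilinear_product smult (\<turnstile>)"
    and left_assoc: "(x \<stileturn> y) \<stileturn> z = x \<stileturn> (y \<stileturn> z)"
    and right_assoc: "(x \<turnstile> y) \<turnstile> z = x \<turnstile> (y \<turnstile> z)"
    and mid_assoc: "(x \<bottom> y) \<bottom> z = x \<bottom> (y \<bottom> z)"
    and left_left_right: "(x \<stileturn> y) \<stileturn> z = x \<stileturn> (y \<turnstile> z)"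
    and left_left_mid: "(x \<stileturn> y) \<stileturn> z = x \<stileturn> (y \<bottom> z)"
    and right_left: "(x \<turnstile> y) \<stileturn> z = x \<turnstile> (y \<stileturn> z)"
    and left_right_right: "(x \<stileturn> y) \<turnstile> z = x \<turnstile> (y \<turnstile> z)"
    and mid_right_right: "(x \<bottom> y) \<turnstile> z = x \<turnstile> (y \<turnstile> z)"
    and mid_left: "(x \<bottom> y) \<stileturn> z = x \<bottom> (y \<stileturn> z)"
    and left_mid_right: "(x \<stileturn> y) \<bottom> z = x \<bottom> (y \<turnstile> z)"
    and right_mid: "(x \<turnstile> y) \<bottom> z = x \<turnstile> (y \<bottom> z)"

locale triassociative_hom =
  A: triassociative_algebra smultA leftA midA rightA +
  B: triassociative_algebra smultB leftB midB rightB +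
  Vector_Spaces.linear smultA smultB \<xi>
  for smultA :: "'k::field \<Rightarrow> 'a::ab_group_add \<Rightarrow> 'a" and leftA midA rightA
    and smultB :: "'k \<Rightarrow> 'b::ab_group_add \<Rightarrow> 'b" and leftB midB rightB
    and \<xi> :: "'a \<Rightarrow> 'b" +
  assumes hom_left: "\<xi> (leftA x y) = leftB (\<xi> x) (\<xi> y)"
    and hom_mid: "\<xi> (midA x y) = midB (\<xi> x) (\<xi> y)"
    and hom_right: "\<xi> (rightA x y) = rightB (\<xi> x) (\<xi> y)"

locale triassociative_subalgebra = triassociative_algebra smult left mid right
  for smult :: "'k::field \<Rightarrow> 'a::ab_group_add \<Rightarrow> 'a"
    and left (infixl \<open>\<stileturn>\<close> 70) and mid (infixl \<open>\<bottom>\<close> 70) and right (infixl \<open>\<turnstile>\<close> 70) +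
  fixes S :: "'a set"
  assumes subspace_carrier: "subspace S"
    and left_closed: "x \<in> S \<Longrightarrow> y \<in> S \<Longrightarrow> x \<stileturn> y \<in> S"
    and mid_closed: "x \<in> S \<Longrightarrow> y \<in> S \<Longrightarrow> x \<bottom> y \<in> S"
    and right_closed: "x \<in> S \<Longrightarrow> y \<in> S \<Longrightarrow> x \<turnstile> y \<in> S"

text \<open>
  The direct sum of spaces on \<^typ>\<open>'a\<close> and \<^typ>\<open>'b\<close> lives on the product type \<^typ>\<open>'a \<times> 'b\<close>, with the
  element \<open>a + b\<close> rendered as \<open>(a, b)\<close>; its scalar multiplication is \<^const>\<open>module_prod.scale\<close>.
\<close>

definition direct_sum_product ::
    "('a \<Rightarrow> 'a \<Rightarrow> 'a) \<Rightarrow> ('b \<Rightarrow> 'b \<Rightarrow> 'b) \<Rightarrow> 'a \<times> 'b \<Rightarrow> 'a \<times> 'b \<Rightarrow> 'a \<times> 'b"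
  where "direct_sum_product f g = (\<lambda>(a1, b1) (a2, b2). (f a1 a2, g b1 b2))"

end

theory Submission
  imports Defs
begin

text \<open>Every operation on the sum acts coordinatewise, so bilinearity and each of the eleven
  identities split into the same statement in A and in B
  (\<open>triassociative_algebra_direct_sum\<close>). For the graph, the product of
  \<open>(x, \<xi> x)\<close> and \<open>(y, \<xi> y)\<close> has as coordinates the product of x
  and y and the product of their images; it lies on the graph exactly when \<xi> preserves that
  product (\<open>direct_sum_product_closed_graph_iff\<close>). Linearity of \<xi> already makes the
  graph a subspace, so being a subalgebra and being a morphism both reduce to closure under the
  three products.\<close>

text \<open>The predicate \<open>Vector_Spaces.linear\<close> bundles the laws of both spaces; with
  these known, only two equations remain, in a form that can be checked coordinatewise.\<close>

lemma linear_iff_vector_space: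
  assumes "vector_space s1" and "vector_space s2"
  shows "Vector_Spaces.linear s1 s2 f \<longleftrightarrow>
    (\<forall>x y. f (x + y) = f x + f y) \<and> (\<forall>c x. f (s1 c x) = s2 c (f x))"
  using assms
  by (auto simp: Vector_Spaces.linear_def module_hom_def module_hom_axioms_def module_iff_vector_space)

lemma vector_space_prod_scale:
  assumes "vector_space s1" and "vector_space s2"
  shows "vector_space (module_prod.scale s1 s2)"
proof -
  interpret vector_space_prod s1 s2
    using assms by (intro vector_space_prod.intro vector_space_pair.intro)
  show ?thesis by (rule p.vector_space_axioms)
qed

lemma direct_sum_product_simp [simp]:
  "direct_sum_product f g (a1, b1) (a2, b2) = (f a1 a2, g b1 b2)"
  by (simp add: direct_sum_product_def)

lemma bilinear_product_direct_sum:
  assumes s1: "vector_space s1" and s2: "vector_space s2"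
    and f: "bilinear_product s1 f" and g: "bilinear_product s2 g"
  shows "bilinear_product (module_prod.scale s1 s2) (direct_sum_product f g)"
proof -
  interpret module_prod s1 s2
    using s1 s2 by (simp add: module_prod_def module_pair_def module_iff_vector_space)
  show ?thesis
    using f g
    unfolding bilinear_product_def linear_iff_vector_space[OF s1 s1]
      linear_iff_vector_space[OF s2 s2]
      linear_iff_vector_space[OF vector_space_prod_scale[OF s1 s2] vector_space_prod_scale[OF s1 s2]]
    by (auto simp: scale_def)
qed

lemma triassociative_algebra_direct_sum:
  assumes "triassociative_algebra smultA leftA midA rightA"
    and "triassociative_algebra smultB leftB midB rightB"
  shows "triassociative_algebra (module_prod.scale smultA smultB)
    (direct_sum_product leftA leftB) (direct_sum_product midA midB)
    (direct_sum_product rightA rightB)"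
proof -
  interpret A: triassociative_algebra smultA leftA midA rightA by fact
  interpret B: triassociative_algebra smultB leftB midB rightB by fact
  note vs = A.vector_space_axioms B.vector_space_axioms
  show ?thesis
  proof (intro triassociative_algebra.intro triassociative_algebra_axioms.intro
      vector_space_prod_scale[OF vs] bilinear_product_direct_sum[OF vs]
      A.bilinear_left A.bilinear_mid A.bilinear_right
      B.bilinear_left B.bilinear_mid B.bilinear_right; clarify)
  \<comment> \<open>Three axioms share the left-hand side
    \<open>(x \<stileturn> y) \<stileturn> z\<close>, so they would compete as rewrite rules; each
    coordinate is instead closed by matching a whole equation.\<close>
  qed (simp_all only: direct_sum_product_simp prod.inject,
      (intro conjI
        A.left_assoc A.right_assoc A.mid_assoc A.left_left_right A.left_left_mid A.right_left
        A.left_right_right A.mid_right_right A.mid_left A.left_mid_right A.right_mid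
        B.left_assoc B.right_assoc B.mid_assoc B.left_left_right B.left_left_mid B.right_left
        B.left_right_right B.mid_right_right B.mid_left B.left_mid_right B.right_mid)+)
qed

text \<open>Additivity and homogeneity keep the second coordinate of a sum or multiple equal to the
  image of the first.\<close>

lemma subspace_graph_linear:
  assumes "Vector_Spaces.linear s1 s2 f"
  shows "module.subspace (module_prod.scale s1 s2) {(x, f x) | x. x \<in> UNIV}"
proof -
  interpret Vector_Spaces.linear s1 s2 f by fact
  interpret module_prod s1 s2 ..
  show ?thesis
    by (auto simp: p.subspace_def scale_def zero_prod_def add scale)
qed

text \<open>The first coordinate \<open>f x y\<close> forces the witness for membership in the
  graph, so the second coordinate must be its image under \<open>h\<close>.\<close>

lemma direct_sum_product_closed_graph_iff:
  "(\<forall>p\<in>{(x, h x) | x. x \<in> UNIV}. \<forall>q\<in>{(x, h x) | x. x \<in> UNIV}.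
      direct_sum_product f g p q \<in> {(x, h x) | x. x \<in> UNIV}) \<longleftrightarrow>
    (\<forall>x y. h (f x y) = g (h x) (h y))"
  by (auto simp: eq_commute)

theorem proposition2p2:
  fixes smultA :: "'k::field \<Rightarrow> 'a::ab_group_add \<Rightarrow> 'a"
    and smultB :: "'k \<Rightarrow> 'b::ab_group_add \<Rightarrow> 'b"
    and leftA midA rightA :: "'a \<Rightarrow> 'a \<Rightarrow> 'a"
    and leftB midB rightB :: "'b \<Rightarrow> 'b \<Rightarrow> 'b"
  assumes "triassociative_algebra smultA leftA midA rightA"
    and "triassociative_algebra smultB leftB midB rightB"
  shows "triassociative_algebra (module_prod.scale smultA smultB)
           (direct_sum_product leftA leftB)
           (direct_sum_product midA midB)
           (direct_sum_product rightA rightB) \<and>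
         (\<forall>\<xi> :: 'a \<Rightarrow> 'b. Vector_Spaces.linear smultA smultB \<xi> \<longrightarrow>
           (triassociative_hom smultA leftA midA rightA smultB leftB midB rightB \<xi> \<longleftrightarrow>
            triassociative_subalgebra (module_prod.scale smultA smultB)
              (direct_sum_product leftA leftB)
              (direct_sum_product midA midB)
              (direct_sum_product rightA rightB)
              {(x, \<xi> x) | x. x \<in> UNIV}))"
proof (intro conjI allI impI)
  show sum: "triassociative_algebra (module_prod.scale smultA smultB)
      (direct_sum_product leftA leftB) (direct_sum_product midA midB)
      (direct_sum_product rightA rightB)"
    using assms by (rule triassociative_algebra_direct_sum)
  fix \<xi> :: "'a \<Rightarrow> 'b"
  assume lin: "Vector_Spaces.linear smultA smultB \<xi>"
  let ?G = "{(x, \<xi> x) | x. x \<in> UNIV}"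
  let ?closed = "\<lambda>f g. \<forall>p\<in>?G. \<forall>q\<in>?G. direct_sum_product f g p q \<in> ?G"
  have "triassociative_hom smultA leftA midA rightA smultB leftB midB rightB \<xi> \<longleftrightarrow>
      ?closed leftA leftB \<and> ?closed midA midB \<and> ?closed rightA rightB"
    unfolding direct_sum_product_closed_graph_iff
    using assms lin by (simp add: triassociative_hom_def triassociative_hom_axioms_def)
  also have "\<dots> \<longleftrightarrow> triassociative_subalgebra (module_prod.scale smultA smultB)
      (direct_sum_product leftA leftB) (direct_sum_product midA midB)
      (direct_sum_product rightA rightB) ?G"
    \<comment> \<open>These two facts discharge the algebra and subspace parts of the subalgebra
      predicate, leaving the three closure conditions.\<close>
    using sum subspace_graph_linear[OF lin]
    unfolding triassociative_subalgebra_def triassociative_subalgebra_axioms_def by blast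
  finally show "triassociative_hom smultA leftA midA rightA smultB leftB midB rightB \<xi> \<longleftrightarrow>
      triassociative_subalgebra (module_prod.scale smultA smultB)
        (direct_sum_product leftA leftB) (direct_sum_product midA midB)
        (direct_sum_product rightA rightB) ?G" .
qed

end
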